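(* Let $F:\mathbb{R}^d\to\mathbb{R}$ attain minimum value $0$, let $\mathcal{S}\subseteq\mathbb{R}^d$ be a desired set, let $\mathcal{A}=(\mathcal{A}_1,\mathcal{A}_2)$ be a (possibly randomized) update procedure, and let $w_0\in\mathbb{R}^d$ be its initialization. Define a sequence $(w_t)_{t\ge 0}$ recursively by $w_{t+1}=\mathcal{A}_1(w_t)$. Let $\mathcal{L}=\{w\in\mathbb{R}^d: F(w)\le F(w_0)\}$. Suppose that for all $u_0\in\mathcal{L}$, $\mathcal{A}$ forms a $(\mathcal{S},t_{\mathrm{oracle}}(u_0),\Delta(u_0),\delta(u_0),u_0)$-decrease procedure. Define $$\overline{\Delta}=\inf_{u\in\mathcal{L}}\frac{\Delta(u)}{t_{\mathrm{oracle}}(u)}.$$ Then with probability at least $$1-\sup_{u\in\mathcal{L}}\delta(u)\cdot\sup_{u\in\mathcal{L}}\left\{\frac{F(w_0)}{\Delta(u)}\right\},$$ upon making $$N=\frac{F(w_0)}{\overline{\Delta}}+\sup_{u\in\mathcal{L}}t_{\mathrm{oracle}}(u)$$ oracle calls, there exists $w_t\in(w_t)_{t\ge0}$ such that $\mathcal{A}_2(w_t)\cap\mathcal{S}\neq\emptyset$ (i.e. for some $w_t$, $\mathcal{A}_2(w_t)$ outputs a sequence of candidate vectors, one of which is in $\mathcal{S}$). Furthermore, if the output of $\mathcal{A}_2$ always has length at most $S$, then the number of candidate vectors outputted is at most $S\cdot\sup_{u\in\mathcal{L}}\left\{\frac{F(w_0)}{\Delta(u)}\right\}$.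
   Context: An update procedure is a (possibly randomized) map $\mathcal{A}=(\mathcal{A}_1,\mathcal{A}_2):\mathbb{R}^d\to\mathbb{R}^d\times\bigcup_{n=0}^\infty(\mathbb{R}^d)^n$. For $u\in\mathbb{R}^d$, $\mathcal{A}_1(u)\in\mathbb{R}^d$ is the future iterate and $\mathcal{A}_2(u)$ is a finite sequence of candidate vectors in $\mathbb{R}^d$; $\mathcal{A}_1(u)$ and $\mathcal{A}_2(u)$ are computed jointly using the same randomness, and each evaluation $\mathcal{A}(w_t)$ depends on the past only through $w_t$ (fresh independent randomness at each evaluation). $\mathcal{A}_2(u)\cap\mathcal{S}\ne\emptyset$ means that at least one entry of the sequence $\mathcal{A}_2(u)$ lies in $\mathcal{S}$. Computing $\mathcal{A}(u)$ uses some number of calls to an oracle (e.g. a gradient oracle); "oracle calls" counts the total number of such calls made while computing $\mathcal{A}(w_0),\mathcal{A}(w_1),\dots$ in succession. Decrease procedure: given a set $\mathcal{S}$, a point $u_0$, a confidence parameter $\delta(u_0)>0$, a decrease threshold $\Delta(u_0)>0$ and a number $t_{\mathrm{oracle}}(u_0)$, one says $\mathcal{A}$ forms a $(\mathcal{S},t_{\mathrm{oracle}}(u_0),\Delta(u_0),\delta(u_0),u_0)$-decrease procedure if, with probability at least $1-\delta(u_0)$ over the randomness in $\mathcal{A}$ to compute $\mathcal{A}(u_0)$ from $u_0$, computing $\mathcal{A}(u_0)$ takes at most $t_{\mathrm{oracle}}(u_0)$ oracle calls and one of the following holds: (1) $F(\mathcal{A}_1(u_0))<F(u_0)-\Delta(u_0)$;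 or (2) $\mathcal{A}_2(u_0)\cap\mathcal{S}\neq\emptyset$.
   Formalization: In the probability bound and the candidate bound, sup F(w0)/Δ(u) is rounded up to the least positive integer at least as large (∞ if infinite); as printed these bounds fail when it is not a positive integer, e.g. when F(w0)=0. *)

theory Defs
  imports "HOL-Probability.Probability"
begin

text \<open>The disjoint-union sigma-algebra on finite sequences of vectors: a set of
  sequences is measurable iff its part of each length \<open>n\<close> is Borel as a subset of the
  \<open>n\<close>-fold product.\<close>

definition borel_list :: "('a::topological_space) list measure" where
  "borel_list = sigma UNIV
     {{xs. length xs = n \<and> (\<forall>i<n. xs ! i \<in> B i)} | n B. \<forall>i<n. B i \<in> sets borel}"

text \<open>A randomized update procedure is a map with a second argument, the random seed, whose
  distribution is \<open>R\<close>. Both components of \<open>A u r\<close> and the number \<open>calls u r\<close> of oracle calls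
  made while computing it use the same seed \<open>r\<close>. A deterministic procedure ignores \<open>r\<close>.\<close>

type_synonym ('d, 'r) update = "real^'d \<Rightarrow> 'r \<Rightarrow> (real^'d) \<times> (real^'d) list"

definition update_procedure ::
    "'r measure \<Rightarrow> ('d::finite, 'r) update \<Rightarrow> (real^'d \<Rightarrow> 'r \<Rightarrow> nat) \<Rightarrow> bool" where
  "update_procedure R A calls \<longleftrightarrow>
     prob_space R \<and>
     (\<lambda>(u, r). A u r) \<in> measurable (borel \<Otimes>\<^sub>M R) (borel \<Otimes>\<^sub>M borel_list) \<and>
     (\<lambda>(u, r). calls u r) \<in> measurable (borel \<Otimes>\<^sub>M R) (count_space UNIV)"

definition decrease_procedure ::
    "'r measure \<Rightarrow> (real^'d \<Rightarrow> real) \<Rightarrow> ('d::finite, 'r) update \<Rightarrow> (real^'d \<Rightarrow> 'r \<Rightarrow> nat)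
      \<Rightarrow> (real^'d) set \<Rightarrow> real \<Rightarrow> real \<Rightarrow> real \<Rightarrow> real^'d \<Rightarrow> bool" where
  "decrease_procedure R F A calls S t_oracle \<Delta> \<delta> u\<^sub>0 \<longleftrightarrow>
     0 \<le> t_oracle \<and> 0 < \<Delta> \<and> 0 < \<delta> \<and>
     \<P>(r in R. real (calls u\<^sub>0 r) \<le> t_oracle \<and>
          (F (fst (A u\<^sub>0 r)) < F u\<^sub>0 - \<Delta> \<or> set (snd (A u\<^sub>0 r)) \<inter> S \<noteq> {})) \<ge> 1 - \<delta>"

text \<open>The run of the procedure on a sequence \<open>x\<close> of seeds, \<open>x t\<close> being the one used to
  compute \<open>A w\<^sub>t\<close>.\<close>

primrec iterate :: "('d::finite, 'r) update \<Rightarrow> real^'d \<Rightarrow> (nat \<Rightarrow> 'r) \<Rightarrow> nat \<Rightarrow> real^'d" where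
  "iterate A w0 x 0 = w0"
| "iterate A w0 x (Suc t) = fst (A (iterate A w0 x t) (x t))"

definition candidates ::
    "('d::finite, 'r) update \<Rightarrow> real^'d \<Rightarrow> (nat \<Rightarrow> 'r) \<Rightarrow> nat \<Rightarrow> (real^'d) list" where
  "candidates A w0 x t = snd (A (iterate A w0 x t) (x t))"

text \<open>Both totals include the evaluation of \<open>A w\<^sub>t\<close> itself.\<close>

definition total_calls ::
    "('d::finite, 'r) update \<Rightarrow> (real^'d \<Rightarrow> 'r \<Rightarrow> nat) \<Rightarrow> real^'d \<Rightarrow> (nat \<Rightarrow> 'r) \<Rightarrow> nat \<Rightarrow> nat" where
  "total_calls A calls w0 x t = (\<Sum>s\<le>t. calls (iterate A w0 x s) (x s))"

definition total_candidates ::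
    "('d::finite, 'r) update \<Rightarrow> real^'d \<Rightarrow> (nat \<Rightarrow> 'r) \<Rightarrow> nat \<Rightarrow> nat" where
  "total_candidates A w0 x t = (\<Sum>s\<le>t. length (candidates A w0 x s))"

text \<open>The least positive integer that is at least \<open>K\<close>, or infinity. It is applied to
  \<open>K = sup (F w\<^sub>0 / \<Delta> u)\<close>, which bounds the number of evaluations of \<open>A\<close>: fewer than \<open>K\<close>
  evaluations can decrease \<open>F\<close>, and one more is needed to reach the desired set. Without
  rounding, the probability bound and the bound on the number of candidates fail, e.g. for
  \<open>K = 0\<close> (\<open>w\<^sub>0\<close> a minimizer, where one evaluation may fail with probability \<open>\<delta> w\<^sub>0\<close>) and for
  \<open>K = 3/2\<close> (where two evaluations may be needed). Nothing changes if \<open>K\<close> is a positive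
  integer.\<close>

definition round_up :: "ereal \<Rightarrow> ereal" where
  "round_up K = (if K = \<infinity> then \<infinity> else ereal (max 1 (of_int \<lceil>real_of_ereal K\<rceil>)))"

end

theory Submission
  imports Defs
begin

text \<open>Call an evaluation at \<open>u \<in> L\<close> good if it either decreases \<open>F\<close> by more than
  \<open>d = F w\<^sub>0 / K\<close> (\<open>d = 0\<close> if \<open>K = 0\<close>) at a price of at most \<open>1 / \<Delta>bar\<close> oracle calls per unit of
  decrease, or hits \<open>S\<close> within \<open>sup t_oracle\<close> calls. As \<open>F \<ge> 0\<close>, the first \<open>round_up K\<close>
  evaluations cannot all decrease \<open>F\<close> in this way, so if they are good then one of them hits,
  and the calls before it telescope. Goodness involves only the extremal constants and not
  the functions \<open>t_oracle\<close>, \<open>\<Delta>\<close>, \<open>\<delta>\<close>, which need not be measurable; hence it is a measurable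
  event in the pair of iterate and seed, it fails with probability at most \<open>sup \<delta>\<close> by
  independence and Fubini, and a union bound over the evaluations concludes.\<close>

section \<open>Deterministic accounting along a single run\<close>

text \<open>Potential argument with \<open>f t * J\<close> as the remaining call budget: a
  decreasing evaluation pays for its calls out of the budget it releases, and the hit adds at most
  \<open>T\<close>. \<open>J\<close> plays 1 / \<open>\<Delta>bar\<close> and may be
  infinite.\<close>

lemma good_run:
  fixes f :: "nat \<Rightarrow> real" and c :: "nat \<Rightarrow> nat" and J T :: ereal
  assumes nonneg: "\<And>t. 0 \<le> f t" "0 \<le> J" "0 \<le> d"
    and k: "0 < k" "f 0 \<le> real k * d"
    and good: "\<And>t. t < k \<Longrightarrow> f t \<le> f 0 \<Longrightarrow>
      (f (Suc t) < f t - d \<and> ereal (real (c t)) \<le> ereal (f t - f (Suc t)) * J) \<or>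
      (H t \<and> ereal (real (c t)) \<le> T)"
  shows "\<exists>t<k. H t \<and> ereal (real (\<Sum>s\<le>t. c s)) \<le> ereal (f 0) * J + T"
proof (rule ccontr)
  assume contra: "\<not> ?thesis"
  \<comment> \<open>The budget stays on the left as a summand, since subtraction would be
    ill-behaved for infinite \<open>J\<close>. Strictness for \<open>t > 0\<close> yields the final
    contradiction at \<open>t = k\<close>, because \<open>f 0 = real k * d\<close> is
    allowed.\<close>
  have "f t \<le> f 0 - real t * d \<and> (0 < t \<longrightarrow> f t < f 0 - real t * d) \<and>
      ereal (real (\<Sum>s<t. c s)) + ereal (f t) * J \<le> ereal (f 0) * J" if "t \<le> k" for t
    using that
  proof (induction t)
    case 0
    then show ?case by simp
  next
    case (Suc t)
    then have IH: "f t \<le> f 0 - real t * d"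
      "ereal (real (\<Sum>s<t. c s)) + ereal (f t) * J \<le> ereal (f 0) * J" and t: "t < k"
      by auto
    have "f t \<le> f 0"
      using IH(1) nonneg(3) by (smt (verit) mult_nonneg_nonneg of_nat_0_le_iff)
    \<comment> \<open>A hit here would refute \<open>contra\<close>: dropping the nonnegative budget
      from the invariant bounds the earlier calls by \<open>f 0 * J\<close>, and this evaluation
      costs at most \<open>T\<close>.\<close>
    have *: "\<not> (H t \<and> ereal (real (c t)) \<le> T)"
    proof
      assume H: "H t \<and> ereal (real (c t)) \<le> T"
      have "0 \<le> ereal (f t) * J" using nonneg by simp
      then have "ereal (real (\<Sum>s<t. c s)) \<le> ereal (f 0) * J"
        using IH(2) by (metis add.right_neutral add_left_mono order_trans)
      with H have "ereal (real (\<Sum>s<t. c s)) + ereal (real (c t)) \<le> ereal (f 0) * J + T"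
        by (intro add_mono) auto
      then have "ereal (real (\<Sum>s\<le>t. c s)) \<le> ereal (f 0) * J + T"
        by (simp flip: lessThan_Suc_atMost)
      with H t contra show False by blast
    qed
    with good[OF t \<open>f t \<le> f 0\<close>] have dec: "f (Suc t) < f t - d"
      "ereal (real (c t)) \<le> ereal (f t - f (Suc t)) * J"
      by auto
    \<comment> \<open>Extended reals distribute here because the decrease and the new value are both
      nonnegative.\<close>
    have "ereal (f t) * J = (ereal (f t - f (Suc t)) + ereal (f (Suc t))) * J" by simp
    also have "\<dots> = ereal (f t - f (Suc t)) * J + ereal (f (Suc t)) * J"
      using dec(1) nonneg(1)[of "Suc t"] nonneg(3) by (intro ereal_left_distrib) auto
    finally have "ereal (real (\<Sum>s<Suc t. c s)) + ereal (f (Suc t)) * J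
        \<le> ereal (real (\<Sum>s<t. c s)) + ereal (f t) * J"
      using dec(2) by (simp add: add_mono add.assoc flip: plus_ereal.simps)
    with IH(2) have "ereal (real (\<Sum>s<Suc t. c s)) + ereal (f (Suc t)) * J \<le> ereal (f 0) * J"
      by (rule order_trans[rotated])
    moreover have "f (Suc t) < f 0 - real (Suc t) * d"
      using dec(1) IH(1) by (simp add: algebra_simps)
    ultimately show ?case by simp
  qed
  from this[of k] k nonneg(1)[of k] show False by simp
qed

text \<open>For finite positive \<open>b\<close> and \<open>t\<close>, this is
  \<open>t \<le> D / b \<le> x / b\<close>. The cases treat the extremes: \<open>b\<close> can be
  infinite only if \<open>t = 0\<close>, and \<open>b = 0\<close> makes the right side infinite
  because \<open>x > 0\<close>.\<close>

lemma cheap_decrease: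
  fixes b :: ereal and x D t :: real
  assumes "0 \<le> b" "b \<le> ereal D / ereal t" "0 \<le> t" "0 < D" "D \<le> x"
  shows "ereal t \<le> ereal x * inverse b"
proof (cases "t = 0")
  case True
  have "0 \<le> ereal x * inverse b" using assms by (simp add: inverse_ereal_ge0I)
  then show ?thesis using True by (simp add: zero_ereal_def)
next
  case False
  with assms have t: "0 < t" by simp
  show ?thesis
  proof (cases b)
    case (real r)
    show ?thesis
    proof (cases "r = 0")
      case True
      then show ?thesis using real assms by simp
    next
      case False
      with real assms t have "0 < r" "r \<le> D / t" by auto
      then have "t \<le> x / r" using t assms(5) by (simp add: field_simps)
      then show ?thesis using real \<open>0 < r\<close> by (simp add: divide_inverse)
    qed
  qed (use assms t in auto)
qed

section \<open>Measurability on finite sequences\<close>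

lemma sets_borel_list_generator:
  assumes "\<And>i. i < n \<Longrightarrow> B i \<in> sets borel"
  shows "{xs. length xs = n \<and> (\<forall>i<n. xs ! i \<in> B i)} \<in> sets borel_list"
  unfolding borel_list_def using assms by (subst sets_measure_of) auto

lemma space_borel_list [simp]: "space borel_list = UNIV"
  unfolding borel_list_def by (subst space_measure_of) auto

lemma measurable_length_borel_list [measurable]:
  "length \<in> measurable borel_list (count_space UNIV)"
  using sets_borel_list_generator[of _ "\<lambda>_. UNIV"]
  by (auto simp: measurable_count_space_eq2_countable vimage_def)

lemma measurable_meets_borel_list [measurable]:
  fixes S :: "'a::topological_space set"
  assumes "S \<in> sets borel"
  shows "Measurable.pred borel_list (\<lambda>xs. set xs \<inter> S \<noteq> {})"
proof -
  \<comment> \<open>Split by length \<open>n\<close> and by a position \<open>i\<close> whose entry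
    lies in \<open>S\<close>; all other positions are unconstrained.\<close>
  have "{xs. set xs \<inter> S \<noteq> {}} = (\<Union>n. \<Union>i\<in>{..<n}.
      {xs. length xs = n \<and> (\<forall>j<n. xs ! j \<in> (if j = i then S else UNIV))})"
    by (fastforce simp: in_set_conv_nth)
  also have "\<dots> \<in> sets borel_list"
    using assms by (intro sets.countable_UN'' sets_borel_list_generator) auto
  finally show ?thesis by (simp add: pred_def)
qed

section \<open>Runs driven by independent seeds\<close>

locale update_scheme =
  fixes R :: "'r measure" and A :: "('d::finite, 'r) update" and calls :: "real^'d \<Rightarrow> 'r \<Rightarrow> nat"
  assumes update: "update_procedure R A calls"
begin

sublocale R: prob_space R
  using update by (simp add: update_procedure_def)

lemma measurable_next [measurable]:
  "(\<lambda>p. fst (A (fst p) (snd p))) \<in> borel_measurable (borel \<Otimes>\<^sub>M R)"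
  using update measurable_fst'' unfolding update_procedure_def
  by (auto simp: case_prod_unfold)

lemma measurable_output [measurable]:
  "(\<lambda>p. snd (A (fst p) (snd p))) \<in> measurable (borel \<Otimes>\<^sub>M R) borel_list"
  using update measurable_snd'' unfolding update_procedure_def
  by (auto simp: case_prod_unfold)

lemma measurable_calls [measurable]:
  "(\<lambda>p. calls (fst p) (snd p)) \<in> measurable (borel \<Otimes>\<^sub>M R) (count_space UNIV)"
  using update unfolding update_procedure_def by (auto simp: case_prod_unfold)

text \<open>Iterate \<open>t\<close> reads only the seeds before \<open>t\<close>. The restricted
  hypothesis lets \<open>prob_step_le\<close> use this for tuples that have just those
  coordinates.\<close>

lemma measurable_iterate:
  assumes "\<And>s. s < t \<Longrightarrow> X s \<in> measurable M R"
  shows "(\<lambda>\<omega>. iterate A w0 (\<lambda>s. X s \<omega>) t) \<in> borel_measurable M"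
  using assms
proof (induction t)
  case (Suc t)
  then have "(\<lambda>\<omega>. (iterate A w0 (\<lambda>s. X s \<omega>) t, X t \<omega>)) \<in> measurable M (borel \<Otimes>\<^sub>M R)"
    by (intro measurable_Pair) auto
  from measurable_compose[OF this measurable_next] show ?case by simp
qed simp

lemma measurable_step:
  assumes "\<And>s. X s \<in> measurable M R" and "f \<in> measurable (borel \<Otimes>\<^sub>M R) N"
  shows "(\<lambda>\<omega>. f (iterate A w0 (\<lambda>s. X s \<omega>) t, X t \<omega>)) \<in> measurable M N"
  using assms by (intro measurable_compose[OF _ assms(2)] measurable_Pair measurable_iterate) auto

text \<open>Iterate \<open>t\<close> is a function of the earlier seeds, hence independent of seed
  \<open>t\<close>. Conditioning on the past freezes the iterate at some \<open>u\<close>, where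
  \<open>le\<close> applies; uniformity in \<open>u\<close> makes the bound survive
  integration.\<close>

lemma prob_step_le:
  assumes "prob_space M"
    and indep: "prob_space.indep_vars M (\<lambda>_. R) X UNIV"
    and distr: "distr M R (X t) = R"
    and B: "Measurable.pred (borel \<Otimes>\<^sub>M R) B"
    and le: "\<And>u. \<P>(r in R. B (u, r)) \<le> e"
  shows "\<P>(\<omega> in M. B (iterate A w0 (\<lambda>s. X s \<omega>) t, X t \<omega>)) \<le> e"
proof -
  interpret M: prob_space M by fact
  have X: "X s \<in> measurable M R" for s
    using indep unfolding M.indep_vars_def by auto
  \<comment> \<open>\<open>Y {..<t}\<close> is the past and \<open>Y {t}\<close> the present seed,
    kept as a one-coordinate tuple to match the independence of restricted families.\<close>
  define Y where "Y I \<omega> = restrict (\<lambda>i. X i \<omega>) I" for I \<omega>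
  let ?P = "\<lambda>I. PiM I (\<lambda>_. R)" and ?D = "\<lambda>I. distr M (PiM I (\<lambda>_. R)) (Y I)"
  have Y [measurable]: "Y I \<in> measurable M (?P I)" for I
    unfolding Y_def by (intro measurable_restrict X)
  have iter_cong: "iterate A w0 x t = iterate A w0 y t" if "\<And>s. s < t \<Longrightarrow> x s = y s" for x y
    using that by (induction t) auto
  have "M.indep_var (?P {..<t}) (Y {..<t}) (?P {t}) (Y {t})"
    unfolding Y_def by (intro M.indep_var_restrict[OF indep]) auto
  then have joint: "distr M (?P {..<t} \<Otimes>\<^sub>M ?P {t}) (\<lambda>\<omega>. (Y {..<t} \<omega>, Y {t} \<omega>)) = ?D {..<t} \<Otimes>\<^sub>M ?D {t}"
    using M.indep_var_distribution_eq[of "?P {..<t}" "Y {..<t}" "?P {t}" "Y {t}"] by simp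
  interpret past: prob_space "?D {..<t}" by (rule M.prob_space_distr) (rule Y)
  interpret present: prob_space "?D {t}" by (rule M.prob_space_distr) (rule Y)
  let ?f = "\<lambda>p. (iterate A w0 (fst p) t, snd p t)"
  define Q where "Q = {p \<in> space (?P {..<t} \<Otimes>\<^sub>M ?P {t}). B (?f p)}"
  have "(\<lambda>p. fst p s) \<in> measurable (?P {..<t} \<Otimes>\<^sub>M ?P {t}) R" if "s < t" for s
    using that by (intro measurable_compose[OF measurable_fst] measurable_component_singleton) simp
  then have "?f \<in> measurable (?P {..<t} \<Otimes>\<^sub>M ?P {t}) (borel \<Otimes>\<^sub>M R)"
    by (intro measurable_Pair measurable_iterate) auto
  from measurable_compose[OF this B] have Q: "Q \<in> sets (?P {..<t} \<Otimes>\<^sub>M ?P {t})"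
    by (simp add: Q_def pred_def)
  have Q': "Q \<in> sets (?D {..<t} \<Otimes>\<^sub>M ?D {t})"
    using Q by (simp cong: sets_pair_measure_cong)
  have e: "0 \<le> e" using le[of undefined] measure_nonneg order_trans by blast
  have iter_Y: "iterate A w0 (Y {..<t} \<omega>) t = iterate A w0 (\<lambda>s. X s \<omega>) t" for \<omega>
    by (rule iter_cong) (simp add: Y_def)
  have "{\<omega> \<in> space M. B (iterate A w0 (\<lambda>s. X s \<omega>) t, X t \<omega>)}
      = (\<lambda>\<omega>. (Y {..<t} \<omega>, Y {t} \<omega>)) -` Q \<inter> space M"
    using measurable_space[OF Y] by (auto simp: Q_def space_pair_measure iter_Y) (simp_all add: Y_def)
  then have "emeasure M {\<omega> \<in> space M. B (iterate A w0 (\<lambda>s. X s \<omega>) t, X t \<omega>)}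
      = emeasure (distr M (?P {..<t} \<Otimes>\<^sub>M ?P {t}) (\<lambda>\<omega>. (Y {..<t} \<omega>, Y {t} \<omega>))) Q"
    using Q by (simp add: emeasure_distr)
  also have "\<dots> = (\<integral>\<^sup>+ x. emeasure (?D {t}) (Pair x -` Q) \<partial>?D {..<t})"
    unfolding joint by (rule present.emeasure_pair_measure_alt[OF Q'])
  also have "\<dots> \<le> (\<integral>\<^sup>+ x. ennreal e \<partial>?D {..<t})"
  proof (rule nn_integral_mono)
    fix x assume x: "x \<in> space (?D {..<t})"
    let ?u = "iterate A w0 x t"
    have sec: "{r \<in> space R. B (?u, r)} \<in> sets R"
      using measurable_compose[OF measurable_Pair1' B, of ?u] by (simp add: pred_def)
    have "emeasure (?D {t}) (Pair x -` Q) = emeasure M (Y {t} -` (Pair x -` Q) \<inter> space M)"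
      using sets_Pair1[OF Q] by (intro emeasure_distr) simp_all
    \<comment> \<open>With the past fixed at \<open>x\<close>, the section of \<open>Q\<close> is an
      event of seed \<open>t\<close> alone, and that seed has law \<open>R\<close>.\<close>
    also have "Y {t} -` (Pair x -` Q) \<inter> space M = X t -` {r \<in> space R. B (?u, r)} \<inter> space M"
      using x measurable_space[OF X] measurable_space[OF Y]
      by (auto simp: Q_def space_pair_measure) (simp_all add: Y_def)
    also have "emeasure M \<dots> = emeasure (distr M R (X t)) {r \<in> space R. B (?u, r)}"
      using X sec by (simp add: emeasure_distr)
    also have "\<dots> \<le> ennreal e"
      unfolding distr using le[of ?u] by (simp add: R.emeasure_eq_measure ennreal_leI)
    finally show "emeasure (?D {t}) (Pair x -` Q) \<le> ennreal e" .
  qed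
  also have "\<dots> = ennreal e" using past.emeasure_space_1 by simp
  finally show ?thesis using e by (simp add: M.emeasure_eq_measure)
qed

text \<open>Union bound: the failure of \<open>E\<close> is covered by the \<open>k\<close> events
  that evaluation \<open>t < k\<close> satisfies \<open>B\<close>, each of probability at most
  \<open>e\<close>.\<close>

lemma prob_run_ge:
  assumes "prob_space M"
    and indep: "prob_space.indep_vars M (\<lambda>_. R) X UNIV"
    and distr: "\<And>t. distr M R (X t) = R"
    and B: "Measurable.pred (borel \<Otimes>\<^sub>M R) B"
    and le: "\<And>u. \<P>(r in R. B (u, r)) \<le> e"
    and E: "Measurable.pred M E"
    and run: "\<And>\<omega>. \<omega> \<in> space M \<Longrightarrow> (\<And>t. t < k \<Longrightarrow> \<not> B (iterate A w0 (\<lambda>s. X s \<omega>) t, X t \<omega>)) \<Longrightarrow> E \<omega>"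
  shows "1 - e * real k \<le> \<P>(\<omega> in M. E \<omega>)"
proof -
  interpret M: prob_space M by fact
  have X: "X s \<in> measurable M R" for s
    using indep unfolding M.indep_vars_def by auto
  let ?B = "\<lambda>t. {\<omega> \<in> space M. B (iterate A w0 (\<lambda>s. X s \<omega>) t, X t \<omega>)}"
  have meas: "?B t \<in> sets M" for t
    using measurable_step[OF X B] by (simp add: pred_def)
  have "1 - \<P>(\<omega> in M. E \<omega>) = M.prob {\<omega> \<in> space M. \<not> E \<omega>}"
    using M.prob_neg[of E] E by (simp add: pred_def)
  also have "\<dots> \<le> M.prob (\<Union>t\<in>{..<k}. ?B t)"
    using run meas by (intro M.finite_measure_mono) auto
  also have "\<dots> \<le> (\<Sum>t<k. M.prob (?B t))"
    using meas by (intro M.finite_measure_subadditive_finite) auto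
  also have "\<dots> \<le> (\<Sum>t<k. e)"
    by (intro sum_mono prob_step_le[OF \<open>prob_space M\<close> indep distr B le])
  finally show ?thesis by (simp add: mult.commute)
qed

end

section \<open>From good evaluations to the probability, call and candidate bounds\<close>

theorem theorem2p1:
  fixes F :: "real^'d \<Rightarrow> real"
    and S :: "(real^'d) set"
    and R :: "'r measure"
    and A :: "('d::finite, 'r) update"
    and calls :: "real^'d \<Rightarrow> 'r \<Rightarrow> nat"
    and w0 :: "real^'d"
    and M :: "'w measure"
    and \<xi> :: "nat \<Rightarrow> 'w \<Rightarrow> 'r"
    and t_oracle \<Delta> \<delta> :: "real^'d \<Rightarrow> real"
    and L :: "(real^'d) set"
    and \<Delta>bar N K \<delta>sup :: ereal
  assumes F_measurable: "F \<in> borel_measurable borel"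
    and F_min: "\<forall>u. 0 \<le> F u" "\<exists>u. F u = 0"
    and S_measurable: "S \<in> sets borel"
    and A_update: "update_procedure R A calls"
    and M_prob: "prob_space M"
    and seeds_indep: "prob_space.indep_vars M (\<lambda>_. R) \<xi> UNIV"
    and seeds_distr: "\<forall>t. distr M R (\<xi> t) = R"
    and L_def: "L = {w. F w \<le> F w0}"
    and decrease: "\<forall>u\<^sub>0\<in>L. decrease_procedure R F A calls S (t_oracle u\<^sub>0) (\<Delta> u\<^sub>0) (\<delta> u\<^sub>0) u\<^sub>0"
    and \<Delta>bar_def: "\<Delta>bar = (INF u\<in>L. ereal (\<Delta> u) / ereal (t_oracle u))"
    and N_def: "N = ereal (F w0) / \<Delta>bar + (SUP u\<in>L. ereal (t_oracle u))"
    and K_def: "K = (SUP u\<in>L. ereal (F w0 / \<Delta> u))"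
    and \<delta>sup_def: "\<delta>sup = (SUP u\<in>L. ereal (\<delta> u))"
  shows "ereal (\<P>(\<omega> in M. \<exists>t.
            set (candidates A w0 (\<lambda>s. \<xi> s \<omega>) t) \<inter> S \<noteq> {} \<and>
            ereal (real (total_calls A calls w0 (\<lambda>s. \<xi> s \<omega>) t)) \<le> N))
          \<ge> 1 - \<delta>sup * round_up K \<and>
        (\<forall>m::nat. (\<forall>u. \<forall>r\<in>space R. length (snd (A u r)) \<le> m) \<longrightarrow>
          ereal (\<P>(\<omega> in M. \<exists>t.
            set (candidates A w0 (\<lambda>s. \<xi> s \<omega>) t) \<inter> S \<noteq> {} \<and>
            ereal (real (total_calls A calls w0 (\<lambda>s. \<xi> s \<omega>) t)) \<le> N \<and>
            ereal (real (total_candidates A w0 (\<lambda>s. \<xi> s \<omega>) t)) \<le> ereal (real m) * round_up K))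
          \<ge> 1 - \<delta>sup * round_up K)"
proof -
  interpret update_scheme R A calls by standard fact
  interpret M: prob_space M by fact
  have \<xi>: "\<xi> s \<in> measurable M R" for s
    using seeds_indep unfolding M.indep_vars_def by auto
  have w0: "w0 \<in> L" by (simp add: L_def)
  note dec = decrease[rule_format, unfolded decrease_procedure_def]
  have "0 \<le> ereal (F w0 / \<Delta> w0)" using F_min dec[OF w0] by simp
  also have "\<dots> \<le> K" unfolding K_def by (rule SUP_upper) fact
  finally have "0 \<le> K" .
  have "0 < ereal (\<delta> w0)" using dec[OF w0] by simp
  also have "\<dots> \<le> \<delta>sup" unfolding \<delta>sup_def by (rule SUP_upper) fact
  finally have "0 < \<delta>sup" .
  have round: "1 \<le> round_up K"
    by (auto simp: round_up_def one_ereal_def)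
  let ?x = "\<lambda>\<omega> s. \<xi> s \<omega>"
  define hit where "hit \<omega> t \<longleftrightarrow> set (candidates A w0 (?x \<omega>) t) \<inter> S \<noteq> {} \<and>
    ereal (real (total_calls A calls w0 (?x \<omega>) t)) \<le> N" for \<omega> t
  have cand_meas: "(\<lambda>\<omega>. candidates A w0 (?x \<omega>) t) \<in> measurable M borel_list" for t
    using measurable_step[OF \<xi> measurable_output] by (simp add: candidates_def)
  have calls_meas: "(\<lambda>\<omega>. calls (iterate A w0 (?x \<omega>) t) (\<xi> t \<omega>)) \<in> measurable M (count_space UNIV)" for t
    using measurable_step[OF \<xi> measurable_calls] by simp
  note [measurable] = cand_meas calls_meas S_measurable F_measurable
  have hit_meas [measurable]: "Measurable.pred M (\<lambda>\<omega>. hit \<omega> t)" for t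
    unfolding hit_def total_calls_def by measurable
  \<comment> \<open>Serves both claims: \<open>E\<close> is any measurable event implied by a hit
    among the first \<open>round_up K\<close> evaluations. Evaluation \<open>t\<close> is number
    \<open>Suc t\<close>, as counting starts at 0.\<close>
  have main: "1 - \<delta>sup * round_up K \<le> ereal (\<P>(\<omega> in M. E \<omega>))"
    if E [measurable]: "Measurable.pred M E"
      and run: "\<And>\<omega> t. \<omega> \<in> space M \<Longrightarrow> hit \<omega> t \<Longrightarrow> ereal (real (Suc t)) \<le> round_up K \<Longrightarrow> E \<omega>"
    for E
  proof (cases "K = \<infinity> \<or> \<delta>sup = \<infinity>")
    case True
    \<comment> \<open>Both factors are positive, so one infinite factor makes the claimed lower
      bound minus infinity.\<close>
    then have "\<delta>sup * round_up K = \<infinity>"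
      using round \<open>0 < \<delta>sup\<close>
      by (cases \<delta>sup; cases "round_up K") (auto simp: round_up_def[of \<infinity>])
    then show ?thesis by (simp only:) (simp add: one_ereal_def)
  next
    case False
    with \<open>0 \<le> K\<close> \<open>0 < \<delta>sup\<close> obtain \<kappa> e where \<kappa>: "K = ereal \<kappa>" and e: "\<delta>sup = ereal e"
      by (cases K; cases \<delta>sup) auto
    have "0 \<le> \<kappa>" using \<open>0 \<le> K\<close> \<kappa> by simp
    define k where "k = nat (max 1 \<lceil>\<kappa>\<rceil>)"
    have k: "round_up K = ereal (real k)"
      by (simp add: round_up_def \<kappa> k_def max_def)
    have "0 < k" "\<kappa> \<le> real k" unfolding k_def by linarith+
    \<comment> \<open>A common decrease size: \<open>d\<close> is at most every
      \<open>\<Delta> u\<close> on \<open>L\<close>, yet \<open>k\<close> decreases of size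
      \<open>d\<close> use up \<open>F w0\<close>. If \<open>\<kappa> = 0\<close>, division by zero
      gives \<open>d = 0\<close>, and \<open>F w0 = 0\<close> as well.\<close>
    define d where "d = F w0 / \<kappa>"
    define T where "T = (SUP u\<in>L. ereal (t_oracle u))"
    define good where "good p \<longleftrightarrow> (let u = fst p; v = fst (A u (snd p)); c = ereal (real (calls u (snd p))) in
        F v < F u - d \<and> c \<le> ereal (F u - F v) * inverse \<Delta>bar \<or>
        set (snd (A u (snd p))) \<inter> S \<noteq> {} \<and> c \<le> T)" for p
    have good_meas [measurable]: "Measurable.pred (borel \<Otimes>\<^sub>M R) good"
      unfolding good_def Let_def by measurable
    have \<Delta>bar: "0 \<le> \<Delta>bar"
      unfolding \<Delta>bar_def using dec by (intro INF_greatest) (auto simp: order_less_imp_le)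
    have F_w0: "F w0 \<le> \<Delta> u * \<kappa>" and \<delta>: "\<delta> u \<le> e" and t: "ereal (t_oracle u) \<le> T"
      and \<Delta>bar_le: "\<Delta>bar \<le> ereal (\<Delta> u) / ereal (t_oracle u)" if "u \<in> L" for u
    proof -
      have "ereal (F w0 / \<Delta> u) \<le> K" unfolding K_def using that by (rule SUP_upper)
      then show "F w0 \<le> \<Delta> u * \<kappa>" using dec[OF that] \<kappa> by (simp add: field_simps)
      have "ereal (\<delta> u) \<le> \<delta>sup" unfolding \<delta>sup_def using that by (rule SUP_upper)
      then show "\<delta> u \<le> e" using e by simp
      show "ereal (t_oracle u) \<le> T" unfolding T_def using that by (rule SUP_upper)
      show "\<Delta>bar \<le> ereal (\<Delta> u) / ereal (t_oracle u)" unfolding \<Delta>bar_def using that by (rule INF_lower)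
    qed
    have d: "0 \<le> d" "F w0 \<le> real k * d"
    proof -
      show "0 \<le> d" using F_min \<open>0 \<le> \<kappa>\<close> by (simp add: d_def)
      show "F w0 \<le> real k * d"
      proof (cases "\<kappa> = 0")
        case True
        then show ?thesis using F_w0[OF w0] by (simp add: d_def)
      next
        case False
        then show ?thesis
          using \<open>0 \<le> \<kappa>\<close> \<open>\<kappa> \<le> real k\<close> F_min(1) mult_left_mono[of \<kappa> "real k" "F w0"]
          by (simp add: d_def field_simps)
      qed
    qed
    have d_le: "d \<le> \<Delta> u" if "u \<in> L" for u
    proof (cases "\<kappa> = 0")
      case True
      then show ?thesis using dec[OF that] by (simp add: d_def)
    next
      case False
      then show ?thesis using \<open>0 \<le> \<kappa>\<close> F_w0[OF that] by (simp add: d_def field_simps)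
    qed
    \<comment> \<open>Intersecting with \<open>L\<close> gives a bound valid at every
      \<open>u\<close>, as outside \<open>L\<close> the event is empty. Nothing is lost, since
      \<open>good_run\<close> asks for goodness only where \<open>f t \<le> f 0\<close>.\<close>
    let ?bad = "\<lambda>p. fst p \<in> L \<and> \<not> good p"
    have bad_meas: "Measurable.pred (borel \<Otimes>\<^sub>M R) ?bad"
      unfolding L_def by measurable
    have bad_le: "\<P>(r in R. ?bad (u, r)) \<le> e" for u
    proof (cases "u \<in> L")
      case False
      then show ?thesis using \<open>0 < \<delta>sup\<close> e by simp
    next
      case True
      note du = dec[OF True]
      have gm: "{r \<in> space R. good (u, r)} \<in> R.events"
        by measurable
      have "1 - e \<le> 1 - \<delta> u" using \<delta>[OF True] by simp
      also have "\<dots> \<le> \<P>(r in R. real (calls u r) \<le> t_oracle u \<and>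
          (F (fst (A u r)) < F u - \<Delta> u \<or> set (snd (A u r)) \<inter> S \<noteq> {}))"
        using du by simp
      \<comment> \<open>The event promised at \<open>u\<close> lies inside the good event: a
        decrease beyond \<open>\<Delta> u\<close> exceeds \<open>d\<close> and is cheap by
        \<open>cheap_decrease\<close>, and a hit costs at most
        \<open>t_oracle u \<le> T\<close>.\<close>
      also have "\<dots> \<le> \<P>(r in R. good (u, r))"
      proof (rule R.finite_measure_mono[OF _ gm], safe)
        fix r assume c: "real (calls u r) \<le> t_oracle u"
        show "good (u, r)" if "F (fst (A u r)) < F u - \<Delta> u"
        proof -
          have "ereal (real (calls u r)) \<le> ereal (t_oracle u)" using c by simp
          also have "\<dots> \<le> ereal (F u - F (fst (A u r))) * inverse \<Delta>bar"
            by (rule cheap_decrease[OF \<Delta>bar \<Delta>bar_le[OF True]]) (use du that in auto)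
          finally show ?thesis using that d_le[OF True] by (simp add: good_def Let_def)
        qed
        show "good (u, r)" if "y \<in> set (snd (A u r))" "y \<in> S" for y
        proof -
          have "ereal (real (calls u r)) \<le> ereal (t_oracle u)" using c by simp
          also have "\<dots> \<le> T" using t[OF True] .
          finally show ?thesis using that by (auto simp: good_def Let_def)
        qed
      qed
      finally show ?thesis using R.prob_neg[OF gm] True by simp
    qed
    have "1 - e * real k \<le> \<P>(\<omega> in M. E \<omega>)"
    proof (rule prob_run_ge[OF M_prob seeds_indep _ bad_meas bad_le E, where ?w0.0 = w0])
      show "distr M R (\<xi> t) = R" for t using seeds_distr by simp
      fix \<omega> assume \<omega>: "\<omega> \<in> space M"
        and ok: "\<And>t. t < k \<Longrightarrow> \<not> ?bad (iterate A w0 (?x \<omega>) t, \<xi> t \<omega>)"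
      have "\<exists>t<k. set (candidates A w0 (?x \<omega>) t) \<inter> S \<noteq> {} \<and>
        ereal (real (\<Sum>s\<le>t. calls (iterate A w0 (?x \<omega>) s) (\<xi> s \<omega>)))
          \<le> ereal (F (iterate A w0 (?x \<omega>) 0)) * inverse \<Delta>bar + T"
      \<comment> \<open>Here \<open>f t\<close> is \<open>F\<close> at iterate \<open>t\<close>, so
        the side condition \<open>f t \<le> f 0\<close> says that the iterate lies in
        \<open>L\<close>.\<close>
      proof (rule good_run[where d = d])
        show "0 \<le> inverse \<Delta>bar" using \<Delta>bar by (rule inverse_ereal_ge0I)
        show "F (iterate A w0 (?x \<omega>) 0) \<le> real k * d" using d by simp
      qed (use ok F_min \<open>0 < k\<close> d in \<open>auto simp: L_def good_def Let_def candidates_def\<close>)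
      then obtain t where "t < k" "hit \<omega> t"
        by (auto simp: hit_def total_calls_def N_def T_def divide_ereal_def)
      then show "E \<omega>" using run[OF \<omega>, of t] k by simp
    qed
    then show ?thesis using k e by (simp add: one_ereal_def)
  qed
  show ?thesis
    \<comment> \<open>Left-nesting the conjunctions exposes \<open>hit\<close> inside the second
      claim.\<close>
    unfolding hit_def[symmetric] conj_assoc[symmetric]
  proof (intro conjI allI impI)
    show "1 - \<delta>sup * round_up K \<le> ereal (\<P>(\<omega> in M. \<exists>t. hit \<omega> t))"
      by (rule main) auto
    fix m :: nat
    assume m: "\<forall>u. \<forall>r\<in>space R. length (snd (A u r)) \<le> m"
    show "1 - \<delta>sup * round_up K \<le> ereal (\<P>(\<omega> in M. \<exists>t. hit \<omega> t \<and>
        ereal (real (total_candidates A w0 (?x \<omega>) t)) \<le> ereal (real m) * round_up K))"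
    proof (rule main)
      show "Measurable.pred M (\<lambda>\<omega>. \<exists>t. hit \<omega> t \<and>
          ereal (real (total_candidates A w0 (?x \<omega>) t)) \<le> ereal (real m) * round_up K)"
        unfolding total_candidates_def by measurable
      fix \<omega> t assume \<omega>: "\<omega> \<in> space M" "hit \<omega> t" and t: "ereal (real (Suc t)) \<le> round_up K"
      \<comment> \<open>A hit at \<open>t\<close> closes \<open>Suc t\<close> evaluations of at most
        \<open>m\<close> candidates each. The length bound is assumed on \<open>space R\<close>
        only, hence the appeal to \<open>measurable_space\<close>.\<close>
      have "total_candidates A w0 (?x \<omega>) t \<le> (\<Sum>s\<le>t. m)"
        unfolding total_candidates_def candidates_def
        using m measurable_space[OF \<xi> \<omega>(1)] by (intro sum_mono) auto
      then have "real (total_candidates A w0 (?x \<omega>) t) \<le> real m * real (Suc t)"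
        by (simp add: mult.commute flip: of_nat_mult of_nat_Suc del: of_nat_Suc)
      then have "ereal (real (total_candidates A w0 (?x \<omega>) t)) \<le> ereal (real m) * ereal (real (Suc t))"
        by simp
      also have "\<dots> \<le> ereal (real m) * round_up K"
        using t by (intro ereal_mult_left_mono) auto
      finally show "\<exists>t. hit \<omega> t \<and>
          ereal (real (total_candidates A w0 (?x \<omega>) t)) \<le> ereal (real m) * round_up K"
        using \<omega> by blast
    qed
  qed
qed

end
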